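(* Let $V$ be a finite-dimensional real inner product space, $\Omega\subseteq V$ a full-dimensional lattice, and $\mathcal{W}\subseteq \mathrm{GL}(V)$ a finite group with $s(\Omega)=\Omega$ for all $s\in\mathcal{W}$. Let $f=\sum_{\mu\in\Omega} f_\mu\,\mathfrak{e}^\mu$ be a $\mathcal{W}$-invariant trigonometric polynomial with $f_\mu=\overline{f_{-\mu}}$. Let $d\in\mathbb{N}$ be such that $\mu\in\Omega_d+\Omega_d$ whenever $f_\mu\neq 0$, and assume $s(\Omega_d)=\Omega_d$ for all $s\in\mathcal{W}$. Define $$f_d:=\min_{\mathbf{X}\in\mathrm{Toep}_d}\ \mathrm{Trace}(\mathbf{mat}(f)\,\mathbf{X})\quad\text{s.t.}\quad \mathbf{X}\succeq 0,\ \mathrm{Trace}(\mathbf{X})=1,$$ $$f_{d,\mathcal{W}}:=\min_{\mathbf{X}\in\mathrm{Toep}_d^{\mathcal{W}}}\ \mathrm{Trace}(\mathbf{mat}(f)\,\mathbf{X})\quad\text{s.t.}\quad \mathbf{X}\succeq 0,\ \mathrm{Trace}(\mathbf{X})=1.$$ Then $f_d=f_{d,\mathcal{W}}$.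
   Context: Let $\langle\cdot,\cdot\rangle$ be the inner product on $V$ with norm $\|u\|=\sqrt{\langle u,u\rangle}$. The dual lattice of $\Omega$ is $\Lambda=\{\lambda\in V \mid \langle\mu,\lambda\rangle\in\mathbb{Z}\ \text{for all}\ \mu\in\Omega\}$. The Voronoi cell of $\Lambda$ is $\mathrm{Vor}(\Lambda)=\{u\in V\mid \|u\|\le\|u-\lambda\|\ \text{for all}\ \lambda\in\Lambda\}$. For $d\in\mathbb{N}=\{0,1,2,\ldots\}$, $\Omega_d:=\Omega\cap d\,\mathrm{Vor}(\Lambda)$, which is a finite set. For $\mu\in\Omega$ and $u\in V$, $\mathfrak{e}^\mu(u):=\exp(-2\pi \mathrm{i}\langle\mu,u\rangle)$. A trigonometric polynomial is a function $f:V\to\mathbb{R}$, $f=\sum_{\mu\in\Omega}f_\mu\,\mathfrak{e}^\mu$ with $f_\mu=\overline{f_{-\mu}}\in\mathbb{C}$, all but finitely many $f_\mu$ being zero. A group element $s\in\mathcal{W}$ acts by $s\cdot f=\sum_{\mu}f_\mu\,\mathfrak{e}^{s(\mu)}$; $f$ is $\mathcal{W}$-invariant if $s\cdot f=f$ for all $s\in\mathcal{W}$. $\mathrm{Toep}_d$ denotes the real vector space of Hermitian matrices $\mathbf{X}$ with complex entries $\mathbf{X}_{\mu\nu}$, rows and columns indexed by $\Omega_d$, that are Toeplitz, meaning that $\mathbf{X}_{\mu\nu}$ depends only on $\mu-\nu$. Let $\mathbf{E}_d(u)$ be the column vector with entries $\mathfrak{e}^\mu(u)/\sqrt{|\Omega_d|}$,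 $\mu\in\Omega_d$. If $\mu\in\Omega_d+\Omega_d$ whenever $f_\mu\ne0$, then $\mathbf{mat}(f)$ denotes the unique matrix in $\mathrm{Toep}_d$ with $f(u)=\mathbf{E}_d(u)^\dagger\,\mathbf{mat}(f)\,\mathbf{E}_d(u)$ for all $u\in V$, where $\dagger$ is the conjugate transpose. $\mathcal{W}$ acts on $\mathrm{Toep}_d$ by $(s\star\mathbf{X})_{\mu\nu}:=\mathbf{X}_{s^{-1}(\mu)\,s^{-1}(\nu)}$, and $\mathrm{Toep}_d^{\mathcal{W}}:=\{\mathbf{X}\in\mathrm{Toep}_d\mid s\star\mathbf{X}=\mathbf{X}\ \text{for all}\ s\in\mathcal{W}\}$. $\mathbf{X}\succeq0$ means that $\mathbf{X}$ is Hermitian positive semi-definite. *)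

theory Defs
  imports "HOL-Analysis.Analysis"
begin

section \<open>Lattices\<close>

text \<open>
  The ambient space \<open>V\<close> is a type of class \<^class>\<open>real_inner\<close>; it is finite-dimensional as soon as it
  carries a full-dimensional lattice in the sense below. The class \<open>euclidean_space\<close> is avoided
  because it excludes the zero space.
\<close>

definition full_lattice :: "'v::real_inner set \<Rightarrow> bool" where
  "full_lattice \<Omega> \<longleftrightarrow> (\<exists>B. finite B \<and> independent B \<and> span B = UNIV \<and>
     \<Omega> = {(\<Sum>b\<in>B. real_of_int (c b) *\<^sub>R b) | c. True})"

definition dual_lattice :: "'v::real_inner set \<Rightarrow> 'v set" where
  "dual_lattice \<Omega> = {l. \<forall>\<mu>\<in>\<Omega>. inner \<mu> l \<in> \<int>}"

definition voronoi_cell :: "'v::real_inner set \<Rightarrow> 'v set" where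
  "voronoi_cell \<Lambda> = {u. \<forall>l\<in>\<Lambda>. norm u \<le> norm (u - l)}"

definition truncated_lattice :: "'v::real_inner set \<Rightarrow> nat \<Rightarrow> 'v set" where
  "truncated_lattice \<Omega> d = \<Omega> \<inter> (\<lambda>u. real d *\<^sub>R u) ` voronoi_cell (dual_lattice \<Omega>)"


section \<open>Finite linear groups\<close>

definition finite_linear_group :: "('v::real_vector \<Rightarrow> 'v) set \<Rightarrow> bool" where
  "finite_linear_group W \<longleftrightarrow> finite W \<and> (\<forall>s\<in>W. linear s \<and> bij s) \<and>
     id \<in> W \<and> (\<forall>s\<in>W. \<forall>t\<in>W. s \<circ> t \<in> W) \<and> (\<forall>s\<in>W. inv s \<in> W)"


section \<open>Trigonometric polynomials\<close>

definition lattice_exp :: "'v::real_inner \<Rightarrow> 'v \<Rightarrow> complex" where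
  "lattice_exp \<mu> u = exp (- 2 * of_real pi * \<i> * of_real (inner \<mu> u))"

definition trig_poly :: "'v::real_inner set \<Rightarrow> ('v \<Rightarrow> complex) \<Rightarrow> ('v \<Rightarrow> real) \<Rightarrow> bool" where
  "trig_poly \<Omega> c f \<longleftrightarrow> finite {\<mu>. c \<mu> \<noteq> 0} \<and> {\<mu>. c \<mu> \<noteq> 0} \<subseteq> \<Omega> \<and>
     (\<forall>\<mu>. c \<mu> = cnj (c (- \<mu>))) \<and>
     (\<forall>u. complex_of_real (f u) = (\<Sum>\<mu> | c \<mu> \<noteq> 0. c \<mu> * lattice_exp \<mu> u))"

text \<open>The function \<open>s \<cdot> f\<close>, where \<open>f\<close> is given by its coefficient family \<open>c\<close>.\<close>

definition trig_act :: "('v::real_inner \<Rightarrow> 'v) \<Rightarrow> ('v \<Rightarrow> complex) \<Rightarrow> 'v \<Rightarrow> complex" where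
  "trig_act s c u = (\<Sum>\<mu> | c \<mu> \<noteq> 0. c \<mu> * lattice_exp (s \<mu>) u)"

definition trig_invariant ::
    "('v::real_inner \<Rightarrow> 'v) set \<Rightarrow> ('v \<Rightarrow> complex) \<Rightarrow> ('v \<Rightarrow> real) \<Rightarrow> bool" where
  "trig_invariant W c f \<longleftrightarrow> (\<forall>s\<in>W. \<forall>u. trig_act s c u = complex_of_real (f u))"


section \<open>Matrices indexed by a finite set\<close>

text \<open>
  A complex matrix with rows and columns indexed by \<open>S\<close> is a function \<^typ>\<open>'v \<Rightarrow> 'v \<Rightarrow> complex\<close> which is
  \<open>0\<close> outside \<open>S \<times> S\<close>, so that equality of matrices is equality of functions.
\<close>

definition hermitian_on :: "'v set \<Rightarrow> ('v \<Rightarrow> 'v \<Rightarrow> complex) \<Rightarrow> bool" where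
  "hermitian_on S X \<longleftrightarrow> (\<forall>\<mu>\<in>S. \<forall>\<nu>\<in>S. X \<mu> \<nu> = cnj (X \<nu> \<mu>))"

definition psd_on :: "'v set \<Rightarrow> ('v \<Rightarrow> 'v \<Rightarrow> complex) \<Rightarrow> bool" where
  "psd_on S X \<longleftrightarrow> hermitian_on S X \<and>
     (\<forall>z :: 'v \<Rightarrow> complex. (\<Sum>\<mu>\<in>S. \<Sum>\<nu>\<in>S. cnj (z \<mu>) * X \<mu> \<nu> * z \<nu>) \<in> \<real>\<^sub>\<ge>\<^sub>0)"

definition trace_on :: "'v set \<Rightarrow> ('v \<Rightarrow> 'v \<Rightarrow> complex) \<Rightarrow> complex" where
  "trace_on S X = (\<Sum>\<mu>\<in>S. X \<mu> \<mu>)"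

definition matmul_on ::
    "'v set \<Rightarrow> ('v \<Rightarrow> 'v \<Rightarrow> complex) \<Rightarrow> ('v \<Rightarrow> 'v \<Rightarrow> complex) \<Rightarrow> 'v \<Rightarrow> 'v \<Rightarrow> complex" where
  "matmul_on S X Y \<mu> \<nu> = (\<Sum>\<kappa>\<in>S. X \<mu> \<kappa> * Y \<kappa> \<nu>)"

definition Toep :: "'v::real_inner set \<Rightarrow> nat \<Rightarrow> ('v \<Rightarrow> 'v \<Rightarrow> complex) set" where
  "Toep \<Omega> d = (let S = truncated_lattice \<Omega> d in
     {X. (\<forall>\<mu> \<nu>. \<not> (\<mu> \<in> S \<and> \<nu> \<in> S) \<longrightarrow> X \<mu> \<nu> = 0) \<and> hermitian_on S X \<and>
         (\<forall>\<mu>\<in>S. \<forall>\<nu>\<in>S. \<forall>\<mu>'\<in>S. \<forall>\<nu>'\<in>S. \<mu> - \<nu> = \<mu>' - \<nu>' \<longrightarrow> X \<mu> \<nu> = X \<mu>' \<nu>')})"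

definition matrix_act :: "('v \<Rightarrow> 'v) \<Rightarrow> ('v \<Rightarrow> 'v \<Rightarrow> complex) \<Rightarrow> 'v \<Rightarrow> 'v \<Rightarrow> complex" where
  "matrix_act s X \<mu> \<nu> = X (inv s \<mu>) (inv s \<nu>)"

definition Toep_inv ::
    "('v::real_inner \<Rightarrow> 'v) set \<Rightarrow> 'v set \<Rightarrow> nat \<Rightarrow> ('v \<Rightarrow> 'v \<Rightarrow> complex) set" where
  "Toep_inv W \<Omega> d = {X \<in> Toep \<Omega> d. \<forall>s\<in>W. matrix_act s X = X}"

definition E_vec :: "'v::real_inner set \<Rightarrow> nat \<Rightarrow> 'v \<Rightarrow> 'v \<Rightarrow> complex" where
  "E_vec \<Omega> d u \<mu> = lattice_exp \<mu> u / of_real (sqrt (real (card (truncated_lattice \<Omega> d))))"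

definition toep_mat :: "'v::real_inner set \<Rightarrow> nat \<Rightarrow> ('v \<Rightarrow> real) \<Rightarrow> 'v \<Rightarrow> 'v \<Rightarrow> complex" where
  "toep_mat \<Omega> d f = (THE M. M \<in> Toep \<Omega> d \<and>
     (\<forall>u. complex_of_real (f u) =
       (\<Sum>\<mu>\<in>truncated_lattice \<Omega> d. \<Sum>\<nu>\<in>truncated_lattice \<Omega> d.
          cnj (E_vec \<Omega> d u \<mu>) * M \<mu> \<nu> * E_vec \<Omega> d u \<nu>)))"


section \<open>The two semidefinite programs\<close>

text \<open>
  The objective values over the matrices in \<open>T\<close>. The trace of a product of two Hermitian matrices
  is real, so taking the real part only changes the type.
\<close>

definition sdp_values ::
    "'v::real_inner set \<Rightarrow> nat \<Rightarrow> ('v \<Rightarrow> real) \<Rightarrow> ('v \<Rightarrow> 'v \<Rightarrow> complex) set \<Rightarrow> real set" where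
  "sdp_values \<Omega> d f T = (let S = truncated_lattice \<Omega> d in
     {Re (trace_on S (matmul_on S (toep_mat \<Omega> d f) X)) | X.
        X \<in> T \<and> psd_on S X \<and> trace_on S X = 1})"

definition is_minimum :: "real set \<Rightarrow> real \<Rightarrow> bool" where
  "is_minimum A m \<longleftrightarrow> m \<in> A \<and> (\<forall>a\<in>A. m \<le> a)"

definition sdp_bound :: "'v::real_inner set \<Rightarrow> nat \<Rightarrow> ('v \<Rightarrow> real) \<Rightarrow> real" where
  "sdp_bound \<Omega> d f = (THE m. is_minimum (sdp_values \<Omega> d f (Toep \<Omega> d)) m)"

definition sdp_bound_inv ::
    "('v::real_inner \<Rightarrow> 'v) set \<Rightarrow> 'v set \<Rightarrow> nat \<Rightarrow> ('v \<Rightarrow> real) \<Rightarrow> real" where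
  "sdp_bound_inv W \<Omega> d f = (THE m. is_minimum (sdp_values \<Omega> d f (Toep_inv W \<Omega> d)) m)"

end

theory Submission
  imports Defs
begin

text \<open>
  Write \<open>S = \<Omega>\<^sub>d\<close>. The index set \<open>S\<close> is finite: the inner products of a point of \<open>d Vor(\<Lambda>)\<close> with the
  dual lattice vectors of a dual basis are bounded, and for a point of \<open>\<Omega>\<close> these are its integer
  coordinates (\<open>finite_truncated_lattice\<close>).

  The two programs have the same set of objective values (\<open>sdp_values_Toep_inv\<close>). An invariant feasible
  matrix is feasible; conversely, a feasible \<open>X\<close> may be replaced by the average \<open>X'\<close> of its
  transforms under \<open>W\<close>, which is an invariant Toeplitz matrix, again positive semi-definite of trace
  \<open>1\<close>. The objective does not change because \<open>mat(f)\<close> is itself fixed by \<open>W\<close>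
  (\<open>matrix_act_toep_mat\<close>): the exponentials are linearly independent
  (\<open>lattice_exp_independent\<close>), so a Toeplitz matrix is determined by the function it represents, and
  the transforms of \<open>mat(f)\<close> all represent \<open>f\<close>.

  The common minimum is attained (\<open>sdp_minimum_exists\<close>): the entries of a positive semi-definite
  matrix of trace \<open>1\<close> have modulus at most \<open>1\<close>, so the feasible set is compact, and it contains
  the multiple of the identity of trace \<open>1\<close>.
\<close>

section \<open>The truncated lattice\<close>

lemma exists_dual_vector:
  fixes B :: "'v::real_inner set"
  assumes "finite B" "independent B" "b \<in> B"
  shows "\<exists>w. inner b w = 1 \<and> (\<forall>b'\<in>B - {b}. inner b' w = 0)"
proof -
  obtain C where C: "finite C" "span C = span (B - {b})" "pairwise orthogonal C"
    using basis_orthogonal[of "B - {b}"] assms(1) by auto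
  define p where "p = (\<Sum>x\<in>C. (inner b x / inner x x) *\<^sub>R x)"
  have p_span: "p \<in> span C"
    unfolding p_def by (intro span_sum span_scale span_base)
  have "orthogonal (b - p) x" if x: "x \<in> C" for x
  proof -
    have "inner p x = (\<Sum>y\<in>C. (inner b y / inner y y) * inner y x)"
      by (simp add: p_def inner_sum_left)
    also have "\<dots> = (\<Sum>y\<in>C. if y = x then inner b x else 0)"
    proof (rule sum.cong[OF refl])
      fix y assume "y \<in> C"
      then show "(inner b y / inner y y) * inner y x = (if y = x then inner b x else 0)"
        using C(3) x by (cases "x = 0") (auto simp: pairwise_def orthogonal_def)
    qed
    also have "\<dots> = inner b x" using C(1) x by simp
    finally show ?thesis by (simp add: orthogonal_def inner_diff_left)
  qed
  then have orth: "orthogonal (b - p) y" if "y \<in> span C" for y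
    using orthogonal_to_span that by blast
  have "b \<noteq> p"
    using p_span C(2) assms(2,3) unfolding dependent_def by auto
  have "inner p (b - p) = 0"
    using orth[OF p_span] by (simp add: orthogonal_def inner_commute)
  then have *: "inner b (b - p) = inner (b - p) (b - p)"
    by (simp add: inner_diff_left)
  have "inner b' (b - p) = 0" if "b' \<in> B - {b}" for b'
    using orth[of b'] span_base[OF that] C(2) by (simp add: orthogonal_def inner_commute)
  then show ?thesis
    using \<open>b \<noteq> p\<close> *
    by (intro exI[of _ "(1 / inner (b - p) (b - p)) *\<^sub>R (b - p)"]) auto
qed

text \<open>
  If \<open>\<mu> \<in> d Vor(\<Lambda>)\<close>, comparing with the lattice points \<open>\<plusminus>l\<close> bounds the inner product of \<open>\<mu>\<close> with
  \<open>l\<close>. Applied to the members of a dual basis, this bounds the integer coordinates of \<open>\<mu>\<close>.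
\<close>

lemma truncated_lattice_inner_bound:
  assumes "\<mu> \<in> truncated_lattice \<Omega> d" "l \<in> dual_lattice \<Omega>"
  shows "\<bar>inner \<mu> l\<bar> \<le> real d * inner l l / 2"
proof -
  obtain u where u: "\<mu> = real d *\<^sub>R u" "u \<in> voronoi_cell (dual_lattice \<Omega>)"
    using assms(1) by (auto simp: truncated_lattice_def)
  have "- l \<in> dual_lattice \<Omega>"
    using assms(2) by (auto simp: dual_lattice_def)
  then have "norm u \<le> norm (u - l)" "norm u \<le> norm (u + l)"
    using u(2) assms(2) by (force simp: voronoi_cell_def)+
  then have "inner u u \<le> inner (u - l) (u - l)" "inner u u \<le> inner (u + l) (u + l)"
    by (simp_all only: norm_le)
  then have "\<bar>inner u l\<bar> \<le> inner l l / 2"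
    by (auto simp: inner_diff_left inner_diff_right inner_add_left inner_add_right inner_commute)
  then have "real d * \<bar>inner u l\<bar> \<le> real d * (inner l l / 2)"
    by (intro mult_left_mono) auto
  then show ?thesis by (simp add: u(1) abs_mult)
qed

lemma finite_truncated_lattice:
  assumes "full_lattice \<Omega>"
  shows "finite (truncated_lattice \<Omega> d)"
proof -
  obtain B where B: "finite B" "independent B"
    and \<Omega>: "\<Omega> = {(\<Sum>b\<in>B. real_of_int (c b) *\<^sub>R b) | c. True}"
    using assms by (auto simp: full_lattice_def)
  obtain w where w: "\<And>b. b \<in> B \<Longrightarrow> inner b (w b) = 1"
      "\<And>b b'. b \<in> B \<Longrightarrow> b' \<in> B - {b} \<Longrightarrow> inner b' (w b) = 0"
    using exists_dual_vector[OF B] by metis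
  have coord: "inner (\<Sum>x\<in>B. real_of_int (c x) *\<^sub>R x) (w b) = real_of_int (c b)" if "b \<in> B" for c b
  proof -
    have "inner (\<Sum>x\<in>B. real_of_int (c x) *\<^sub>R x) (w b) = (\<Sum>x\<in>B. real_of_int (c x) * inner x (w b))"
      by (simp add: inner_sum_left)
    also have "\<dots> = (\<Sum>x\<in>B. if x = b then real_of_int (c b) else 0)"
      using w that by (intro sum.cong) auto
    finally show ?thesis using B(1) that by simp
  qed
  then have w_dual: "w b \<in> dual_lattice \<Omega>" if "b \<in> B" for b
    using that by (auto simp: dual_lattice_def \<Omega>)
  define K where "K b = \<lfloor>real d * inner (w b) (w b) / 2\<rfloor>" for b
  have "truncated_lattice \<Omega> d
      \<subseteq> (\<lambda>c. \<Sum>b\<in>B. real_of_int (c b) *\<^sub>R b) ` (PiE B (\<lambda>b. {- K b..K b}))"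
  proof
    fix \<mu> assume \<mu>: "\<mu> \<in> truncated_lattice \<Omega> d"
    then obtain c where c: "\<mu> = (\<Sum>b\<in>B. real_of_int (c b) *\<^sub>R b)"
      by (auto simp: truncated_lattice_def \<Omega>)
    have "c b \<in> {- K b..K b}" if "b \<in> B" for b
    proof -
      have "\<bar>real_of_int (c b)\<bar> \<le> real d * inner (w b) (w b) / 2"
        using truncated_lattice_inner_bound[OF \<mu> w_dual[OF that]] coord[OF that] c by simp
      then have "\<bar>c b\<bar> \<le> K b"
        unfolding K_def by (simp add: le_floor_iff)
      then show ?thesis by auto
    qed
    then have "restrict c B \<in> PiE B (\<lambda>b. {- K b..K b})" by auto
    moreover have "\<mu> = (\<Sum>b\<in>B. real_of_int (restrict c B b) *\<^sub>R b)"
      unfolding c by (intro sum.cong) auto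
    ultimately show "\<mu> \<in> (\<lambda>c. \<Sum>b\<in>B. real_of_int (c b) *\<^sub>R b) ` (PiE B (\<lambda>b. {- K b..K b}))"
      by blast
  qed
  then show ?thesis
    by (rule finite_subset) (intro finite_imageI finite_PiE B(1) finite_atLeastAtMost_int)
qed

lemma zero_in_truncated_lattice:
  assumes "full_lattice \<Omega>"
  shows "0 \<in> truncated_lattice \<Omega> d"
proof -
  have "0 \<in> \<Omega>"
    using assms unfolding full_lattice_def
    by (force intro: exI[of _ "\<lambda>_. 0"])
  then show ?thesis
    by (auto simp: truncated_lattice_def voronoi_cell_def intro!: image_eqI[of _ _ 0])
qed

lemma uminus_in_truncated_lattice:
  assumes "full_lattice \<Omega>" "\<mu> \<in> truncated_lattice \<Omega> d"
  shows "- \<mu> \<in> truncated_lattice \<Omega> d"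
proof -
  obtain u where u: "\<mu> = real d *\<^sub>R u" "u \<in> voronoi_cell (dual_lattice \<Omega>)" and "\<mu> \<in> \<Omega>"
    using assms(2) by (auto simp: truncated_lattice_def)
  obtain B where \<Omega>: "\<Omega> = {(\<Sum>b\<in>B. real_of_int (c b) *\<^sub>R b) | c. True}"
    using assms(1) by (auto simp: full_lattice_def)
  obtain c where "\<mu> = (\<Sum>b\<in>B. real_of_int (c b) *\<^sub>R b)"
    using \<open>\<mu> \<in> \<Omega>\<close> \<Omega> by auto
  then have "- \<mu> = (\<Sum>b\<in>B. real_of_int (- c b) *\<^sub>R b)"
    by (simp add: sum_negf)
  then have "- \<mu> \<in> \<Omega>" unfolding \<Omega> mem_Collect_eq by (intro exI[of _ "\<lambda>b. - c b"]) simp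
  moreover have "- u \<in> voronoi_cell (dual_lattice \<Omega>)"
  proof -
    have "norm (- u) \<le> norm (- u - l)" if "l \<in> dual_lattice \<Omega>" for l
    proof -
      have "- l \<in> dual_lattice \<Omega>" using that by (auto simp: dual_lattice_def)
      then have "norm u \<le> norm (u - - l)" using u(2) unfolding voronoi_cell_def by blast
      also have "\<dots> = norm (- u - l)" using norm_minus_cancel[of "u + l"] by simp
      finally show ?thesis by simp
    qed
    then show ?thesis by (auto simp: voronoi_cell_def)
  qed
  moreover have "- \<mu> = real d *\<^sub>R (- u)" using u(1) by simp
  ultimately show ?thesis unfolding truncated_lattice_def by blast
qed


section \<open>Independence of the exponentials\<close>

lemma lattice_exp_zero [simp]: "lattice_exp \<mu> 0 = 1"
  by (simp add: lattice_exp_def)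

lemma lattice_exp_add: "lattice_exp \<mu> (u + v) = lattice_exp \<mu> u * lattice_exp \<mu> v"
  by (simp add: lattice_exp_def inner_add_right distrib_left flip: exp_add)

lemma cnj_lattice_exp_mult: "cnj (lattice_exp \<mu> u) * lattice_exp \<nu> u = lattice_exp (\<nu> - \<mu>) u"
  by (simp add: lattice_exp_def exp_cnj inner_diff_left algebra_simps flip: exp_add)

lemma lattice_exp_distinct:
  assumes "\<mu> \<noteq> \<nu>"
  shows "\<exists>v. lattice_exp \<mu> v \<noteq> lattice_exp \<nu> v"
proof -
  define w where "w = \<mu> - \<nu>"
  \<comment> \<open>The scaling makes the two phases differ by exactly \<open>\<pi>\<close>.\<close>
  define v where "v = (1 / (2 * inner w w)) *\<^sub>R w"
  have "inner w v = 1 / 2"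
    using assms by (simp add: v_def w_def)
  then have "inner \<mu> v = inner \<nu> v + 1 / 2"
    by (simp add: w_def inner_diff_left)
  then have "lattice_exp \<mu> v = lattice_exp \<nu> v * exp (- (\<i> * of_real pi))"
    by (simp add: lattice_exp_def algebra_simps flip: exp_add)
  also have "exp (- (\<i> * of_real pi)) = - 1"
    by (simp add: exp_minus)
  finally have "lattice_exp \<mu> v = - lattice_exp \<nu> v" by simp
  moreover have "lattice_exp \<nu> v \<noteq> 0" by (simp add: lattice_exp_def)
  ultimately have "lattice_exp \<mu> v \<noteq> lattice_exp \<nu> v" by auto
  then show ?thesis ..
qed

text \<open>Dedekind's argument for the independence of distinct characters.\<close>

lemma lattice_exp_independent:
  assumes "finite F" "\<And>u. (\<Sum>\<mu>\<in>F. a \<mu> * lattice_exp \<mu> u) = 0" "\<mu> \<in> F"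
  shows "a \<mu> = 0"
  using assms
proof (induction F arbitrary: a \<mu> rule: finite_induct)
  case (insert \<nu> F)
  have sum0: "a \<nu> * lattice_exp \<nu> u + (\<Sum>\<mu>\<in>F. a \<mu> * lattice_exp \<mu> u) = 0" for u
    using insert.prems(1)[of u] insert.hyps by simp
  have F0: "a \<mu> = 0" if \<mu>: "\<mu> \<in> F" for \<mu>
  proof -
    obtain v where v: "lattice_exp \<mu> v \<noteq> lattice_exp \<nu> v"
      using lattice_exp_distinct[of \<mu> \<nu>] insert.hyps \<mu> by blast
    have "(\<Sum>\<mu>\<in>F. (a \<mu> * (lattice_exp \<mu> v - lattice_exp \<nu> v)) * lattice_exp \<mu> u) = 0" for u
    proof -
      \<comment> \<open>Translate the relation by \<open>v\<close> and subtract a multiple of it to cancel the \<open>\<nu>\<close> term.\<close>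
      have "(\<Sum>\<mu>\<in>F. (a \<mu> * (lattice_exp \<mu> v - lattice_exp \<nu> v)) * lattice_exp \<mu> u)
          = (a \<nu> * lattice_exp \<nu> (u + v) + (\<Sum>\<mu>\<in>F. a \<mu> * lattice_exp \<mu> (u + v)))
            - lattice_exp \<nu> v * (a \<nu> * lattice_exp \<nu> u + (\<Sum>\<mu>\<in>F. a \<mu> * lattice_exp \<mu> u))"
        by (simp add: lattice_exp_add algebra_simps sum_distrib_left sum_subtractf)
      then show ?thesis by (simp add: sum0)
    qed
    from insert.IH[OF this \<mu>] v show ?thesis by simp
  qed
  then have "a \<nu> = 0" using sum0[of 0] by simp
  with F0 insert.prems(2) show ?case by auto
qed simp


section \<open>Toeplitz matrices\<close>

text \<open>The positions \<open>(\<mu>, \<nu>)\<close> of a matrix indexed by \<open>S\<close> that lie on the diagonal \<open>\<nu> - \<mu> = \<delta>\<close>.\<close>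

definition diagonal_on :: "'v::ab_group_add set \<Rightarrow> 'v \<Rightarrow> ('v \<times> 'v) set" where
  "diagonal_on S \<delta> = {p \<in> S \<times> S. snd p - fst p = \<delta>}"

lemma finite_diagonal_on [simp]: "finite S \<Longrightarrow> finite (diagonal_on S \<delta>)"
  by (simp add: diagonal_on_def)

lemma card_diagonal_on_pos:
  assumes "finite S" "\<mu> \<in> S" "\<nu> \<in> S"
  shows "card (diagonal_on S (\<nu> - \<mu>)) > 0"
proof -
  have "(\<mu>, \<nu>) \<in> diagonal_on S (\<nu> - \<mu>)" using assms by (simp add: diagonal_on_def)
  then show ?thesis using assms(1) by (metis card_gt_0_iff empty_iff finite_diagonal_on)
qed

lemma card_diagonal_on_uminus: "card (diagonal_on S (- \<delta>)) = card (diagonal_on S \<delta>)"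
proof -
  have "diagonal_on S (- \<delta>) = prod.swap ` diagonal_on S \<delta>"
  proof (intro equalityI subsetI)
    fix p assume "p \<in> diagonal_on S (- \<delta>)"
    then show "p \<in> prod.swap ` diagonal_on S \<delta>"
      by (intro image_eqI[of _ _ "prod.swap p"]) (auto simp: diagonal_on_def algebra_simps)
  qed (auto simp: diagonal_on_def)
  then show ?thesis by (simp add: card_image)
qed

lemma sum_by_diagonals:
  fixes g :: "'v::ab_group_add \<Rightarrow> 'v \<Rightarrow> complex"
  assumes "finite S"
  shows "(\<Sum>\<mu>\<in>S. \<Sum>\<nu>\<in>S. g \<mu> \<nu>) =
    (\<Sum>\<delta>\<in>(\<lambda>p. snd p - fst p) ` (S \<times> S). \<Sum>p\<in>diagonal_on S \<delta>. g (fst p) (snd p))"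
proof -
  have "(\<Sum>\<mu>\<in>S. \<Sum>\<nu>\<in>S. g \<mu> \<nu>) = (\<Sum>p\<in>S \<times> S. g (fst p) (snd p))"
    by (simp add: sum.cartesian_product split_def)
  also have "\<dots> = (\<Sum>\<delta>\<in>(\<lambda>p. snd p - fst p) ` (S \<times> S). \<Sum>p\<in>diagonal_on S \<delta>. g (fst p) (snd p))"
    unfolding diagonal_on_def using assms by (intro sum.image_gen) auto
  finally show ?thesis .
qed

text \<open>Spreading a coefficient family evenly over the diagonals does not change its total.\<close>

lemma sum_spread_diagonals:
  fixes h :: "'v::ab_group_add \<Rightarrow> complex"
  assumes "finite S" "\<And>\<delta>. h \<delta> \<noteq> 0 \<Longrightarrow> \<exists>\<mu>\<in>S. \<exists>\<nu>\<in>S. \<delta> = \<nu> - \<mu>"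
    and "finite A" "{\<delta>. h \<delta> \<noteq> 0} \<subseteq> A"
  shows "(\<Sum>\<mu>\<in>S. \<Sum>\<nu>\<in>S. h (\<nu> - \<mu>) / of_nat (card (diagonal_on S (\<nu> - \<mu>)))) = (\<Sum>\<delta>\<in>A. h \<delta>)"
proof -
  let ?D = "(\<lambda>p. snd p - fst p) ` (S \<times> S)"
  have "(\<Sum>\<mu>\<in>S. \<Sum>\<nu>\<in>S. h (\<nu> - \<mu>) / of_nat (card (diagonal_on S (\<nu> - \<mu>))))
      = (\<Sum>\<delta>\<in>?D. \<Sum>p\<in>diagonal_on S \<delta>.
          h (snd p - fst p) / of_nat (card (diagonal_on S (snd p - fst p))))"
    by (rule sum_by_diagonals[OF assms(1)])
  also have "\<dots> = (\<Sum>\<delta>\<in>?D. h \<delta>)"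
  proof (rule sum.cong[OF refl])
    fix \<delta> assume "\<delta> \<in> ?D"
    then obtain \<mu> \<nu> where "\<mu> \<in> S" "\<nu> \<in> S" "\<delta> = \<nu> - \<mu>" by auto
    then have "card (diagonal_on S \<delta>) > 0" using card_diagonal_on_pos[OF assms(1)] by blast
    moreover have "(\<Sum>p\<in>diagonal_on S \<delta>. h (snd p - fst p) / of_nat (card (diagonal_on S (snd p - fst p))))
        = (\<Sum>p\<in>diagonal_on S \<delta>. h \<delta> / of_nat (card (diagonal_on S \<delta>)))"
      by (intro sum.cong) (auto simp: diagonal_on_def)
    ultimately show "(\<Sum>p\<in>diagonal_on S \<delta>.
        h (snd p - fst p) / of_nat (card (diagonal_on S (snd p - fst p)))) = h \<delta>"
      by simp
  qed
  also have "\<dots> = (\<Sum>\<delta>\<in>{\<delta>. h \<delta> \<noteq> 0}. h \<delta>)"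
    using assms(1,2) by (intro sum.mono_neutral_right) force+
  also have "\<dots> = (\<Sum>\<delta>\<in>A. h \<delta>)"
    using assms(3,4) by (intro sum.mono_neutral_left) auto
  finally show ?thesis .
qed

text \<open>
  Up to the factor \<open>1 / |S|\<close>, the function represented by \<open>M\<close> is the sum of \<open>M\<^bsub>\<mu>\<nu>\<^esub>\<close> times the
  exponential of \<open>\<nu> - \<mu>\<close>.
\<close>

lemma E_vec_form:
  assumes "finite (truncated_lattice \<Omega> d)"
  shows "(\<Sum>\<mu>\<in>truncated_lattice \<Omega> d. \<Sum>\<nu>\<in>truncated_lattice \<Omega> d.
      cnj (E_vec \<Omega> d u \<mu>) * M \<mu> \<nu> * E_vec \<Omega> d u \<nu>) =
    (\<Sum>\<mu>\<in>truncated_lattice \<Omega> d. \<Sum>\<nu>\<in>truncated_lattice \<Omega> d. M \<mu> \<nu> * lattice_exp (\<nu> - \<mu>) u)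
      / of_nat (card (truncated_lattice \<Omega> d))"
proof -
  have sq: "complex_of_real (sqrt (real n)) * complex_of_real (sqrt (real n)) = of_nat n" for n
    by (simp flip: of_real_mult)
  have "cnj (E_vec \<Omega> d u \<mu>) * M \<mu> \<nu> * E_vec \<Omega> d u \<nu>
      = M \<mu> \<nu> * lattice_exp (\<nu> - \<mu>) u / of_nat (card (truncated_lattice \<Omega> d))" for \<mu> \<nu>
    using sq[of "card (truncated_lattice \<Omega> d)"] cnj_lattice_exp_mult[of \<mu> u \<nu>]
    by (simp add: E_vec_def mult_ac flip: cnj_lattice_exp_mult)
  then show ?thesis by (simp add: sum_divide_distrib)
qed

text \<open>
  By independence, the represented function determines the sum along each diagonal, and hence the
  constant value of a Toeplitz matrix there.
\<close>

lemma Toep_eqI: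
  assumes fin: "finite (truncated_lattice \<Omega> d)"
    and "M \<in> Toep \<Omega> d" "M' \<in> Toep \<Omega> d"
    and eq: "\<And>u. (\<Sum>\<mu>\<in>truncated_lattice \<Omega> d. \<Sum>\<nu>\<in>truncated_lattice \<Omega> d. M \<mu> \<nu> * lattice_exp (\<nu> - \<mu>) u)
      = (\<Sum>\<mu>\<in>truncated_lattice \<Omega> d. \<Sum>\<nu>\<in>truncated_lattice \<Omega> d. M' \<mu> \<nu> * lattice_exp (\<nu> - \<mu>) u)"
  shows "M = M'"
proof -
  let ?S = "truncated_lattice \<Omega> d"
  let ?D = "(\<lambda>p. snd p - fst p) ` (?S \<times> ?S)"
  define X where "X \<mu> \<nu> = M \<mu> \<nu> - M' \<mu> \<nu>" for \<mu> \<nu>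
  have toep: "X \<mu> \<nu> = X \<mu>' \<nu>'"
    if "\<mu> \<in> ?S" "\<nu> \<in> ?S" "\<mu>' \<in> ?S" "\<nu>' \<in> ?S" "\<nu> - \<mu> = \<nu>' - \<mu>'" for \<mu> \<nu> \<mu>' \<nu>'
  proof -
    have "\<mu> - \<nu> = \<mu>' - \<nu>'" using that(5) by (metis minus_diff_eq)
    then show ?thesis
      using assms(2,3) that(1-4) unfolding X_def Toep_def Let_def mem_Collect_eq by metis
  qed
  define a where "a \<delta> = (\<Sum>p\<in>diagonal_on ?S \<delta>. X (fst p) (snd p))" for \<delta>
  have "(\<Sum>\<delta>\<in>?D. a \<delta> * lattice_exp \<delta> u) = 0" for u
  proof -
    have "(\<Sum>\<delta>\<in>?D. a \<delta> * lattice_exp \<delta> u)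
        = (\<Sum>\<delta>\<in>?D. \<Sum>p\<in>diagonal_on ?S \<delta>. X (fst p) (snd p) * lattice_exp (snd p - fst p) u)"
      unfolding a_def sum_distrib_right by (intro sum.cong refl) (auto simp: diagonal_on_def)
    also have "\<dots> = (\<Sum>\<mu>\<in>?S. \<Sum>\<nu>\<in>?S. X \<mu> \<nu> * lattice_exp (\<nu> - \<mu>) u)"
      by (rule sum_by_diagonals[OF fin, symmetric])
    also have "\<dots> = 0" using eq[of u] by (simp add: X_def left_diff_distrib sum_subtractf)
    finally show ?thesis .
  qed
  then have a0: "a \<delta> = 0" if "\<delta> \<in> ?D" for \<delta>
    using lattice_exp_independent[of ?D a \<delta>] fin that by blast
  have "X \<mu> \<nu> = 0" if "\<mu> \<in> ?S" "\<nu> \<in> ?S" for \<mu> \<nu>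
  proof -
    have "a (\<nu> - \<mu>) = (\<Sum>p\<in>diagonal_on ?S (\<nu> - \<mu>). X \<mu> \<nu>)"
      unfolding a_def by (intro sum.cong refl toep) (use that in \<open>auto simp: diagonal_on_def\<close>)
    also have "\<dots> = of_nat (card (diagonal_on ?S (\<nu> - \<mu>))) * X \<mu> \<nu>" by simp
    finally have "of_nat (card (diagonal_on ?S (\<nu> - \<mu>))) * X \<mu> \<nu> = 0"
      using a0[of "\<nu> - \<mu>"] that by force
    then show ?thesis
      using card_diagonal_on_pos[OF fin that] by simp
  qed
  moreover have "X \<mu> \<nu> = 0" if "\<not> (\<mu> \<in> ?S \<and> \<nu> \<in> ?S)" for \<mu> \<nu>
    using assms(2,3) that by (auto simp: X_def Toep_def Let_def)
  ultimately have "X \<mu> \<nu> = 0" for \<mu> \<nu> by blast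
  then show ?thesis by (auto simp: X_def fun_eq_iff)
qed


section \<open>The group action on matrices\<close>

lemma finite_linear_groupD:
  assumes "finite_linear_group W" "s \<in> W"
  shows "linear s" "bij s"
  using assms by (auto simp: finite_linear_group_def)

lemma sum_matrix_act:
  fixes g :: "'v \<Rightarrow> 'v \<Rightarrow> complex \<Rightarrow> complex"
  assumes "bij s" "s ` S = S"
  shows "(\<Sum>\<mu>\<in>S. \<Sum>\<nu>\<in>S. g \<mu> \<nu> (matrix_act s X \<mu> \<nu>)) = (\<Sum>\<mu>\<in>S. \<Sum>\<nu>\<in>S. g (s \<mu>) (s \<nu>) (X \<mu> \<nu>))"
proof -
  have bij: "bij_betw s S S"
    using assms by (metis bij_betw_def bij_betw_subset subset_UNIV)
  have inv: "inv s (s x) = x" for x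
    using assms(1) by (simp add: bij_is_inj)
  have "(\<Sum>\<mu>\<in>S. \<Sum>\<nu>\<in>S. g \<mu> \<nu> (matrix_act s X \<mu> \<nu>))
      = (\<Sum>\<mu>\<in>S. \<Sum>\<nu>\<in>S. g (s \<mu>) \<nu> (matrix_act s X (s \<mu>) \<nu>))"
    by (rule sum.reindex_bij_betw[OF bij, symmetric])
  also have "\<dots> = (\<Sum>\<mu>\<in>S. \<Sum>\<nu>\<in>S. g (s \<mu>) (s \<nu>) (matrix_act s X (s \<mu>) (s \<nu>)))"
    by (intro sum.cong refl sum.reindex_bij_betw[OF bij, symmetric])
  finally show ?thesis by (simp add: matrix_act_def inv)
qed

lemma trace_matrix_act:
  assumes "bij s" "s ` S = S"
  shows "trace_on S (matrix_act s X) = trace_on S X"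
proof -
  have bij: "bij_betw s S S"
    using assms by (metis bij_betw_def bij_betw_subset subset_UNIV)
  have "trace_on S (matrix_act s X) = (\<Sum>\<mu>\<in>S. matrix_act s X (s \<mu>) (s \<mu>))"
    unfolding trace_on_def by (rule sum.reindex_bij_betw[OF bij, symmetric])
  also have "\<dots> = trace_on S X"
    using assms(1) by (simp add: trace_on_def matrix_act_def bij_is_inj)
  finally show ?thesis .
qed

lemma psd_onD:
  "psd_on S X \<Longrightarrow> (\<Sum>\<mu>\<in>S. \<Sum>\<nu>\<in>S. cnj (z \<mu>) * X \<mu> \<nu> * z \<nu>) \<in> \<real>\<^sub>\<ge>\<^sub>0"
  by (simp add: psd_on_def)

lemma psd_matrix_act:
  assumes "bij s" "s ` S = S" "psd_on S X"
  shows "psd_on S (matrix_act s X)"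
proof -
  have S: "inv s x \<in> S" if "x \<in> S" for x
    using assms(1,2) that by (metis bij_is_inj image_iff inv_f_f)
  have "(\<Sum>\<mu>\<in>S. \<Sum>\<nu>\<in>S. cnj (z \<mu>) * matrix_act s X \<mu> \<nu> * z \<nu>) \<in> \<real>\<^sub>\<ge>\<^sub>0" for z
  proof -
    have "(\<Sum>\<mu>\<in>S. \<Sum>\<nu>\<in>S. cnj (z \<mu>) * matrix_act s X \<mu> \<nu> * z \<nu>)
        = (\<Sum>\<mu>\<in>S. \<Sum>\<nu>\<in>S. cnj ((z \<circ> s) \<mu>) * X \<mu> \<nu> * (z \<circ> s) \<nu>)"
      using sum_matrix_act[OF assms(1,2), of "\<lambda>\<mu> \<nu> y. cnj (z \<mu>) * y * z \<nu>"] by simp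
    then show ?thesis using psd_onD[OF assms(3), of "z \<circ> s"] by (simp only:)
  qed
  moreover have "hermitian_on S (matrix_act s X)"
    using assms(3) S unfolding psd_on_def hermitian_on_def matrix_act_def by blast
  ultimately show ?thesis by (simp add: psd_on_def)
qed

lemma Toep_matrix_act:
  assumes "linear s" "bij s" "s ` truncated_lattice \<Omega> d = truncated_lattice \<Omega> d" "X \<in> Toep \<Omega> d"
  shows "matrix_act s X \<in> Toep \<Omega> d"
proof -
  let ?S = "truncated_lattice \<Omega> d"
  have S: "inv s x \<in> ?S \<longleftrightarrow> x \<in> ?S" for x
    using assms(2,3) by (metis bij_inv_eq_iff image_iff)
  have diff: "inv s \<mu> - inv s \<nu> = inv s (\<mu> - \<nu>)" for \<mu> \<nu>
  proof -
    have "s (inv s \<mu> - inv s \<nu>) = \<mu> - \<nu>"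
      using assms(1,2) by (simp add: linear_diff bij_is_surj surj_f_inv_f)
    then show ?thesis using assms(2) by (metis bij_inv_eq_iff)
  qed
  have X: "\<And>\<mu> \<nu>. \<not> (\<mu> \<in> ?S \<and> \<nu> \<in> ?S) \<Longrightarrow> X \<mu> \<nu> = 0" "hermitian_on ?S X"
    "\<And>\<mu> \<nu> \<mu>' \<nu>'. \<mu> \<in> ?S \<Longrightarrow> \<nu> \<in> ?S \<Longrightarrow> \<mu>' \<in> ?S \<Longrightarrow> \<nu>' \<in> ?S \<Longrightarrow> \<mu> - \<nu> = \<mu>' - \<nu>' \<Longrightarrow> X \<mu> \<nu> = X \<mu>' \<nu>'"
    using assms(4) unfolding Toep_def Let_def by blast+
  show ?thesis
    unfolding Toep_def Let_def mem_Collect_eq matrix_act_def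
  proof (intro conjI ballI allI impI)
    show "X (inv s \<mu>) (inv s \<nu>) = 0" if "\<not> (\<mu> \<in> ?S \<and> \<nu> \<in> ?S)" for \<mu> \<nu>
      using X(1) S that by blast
    show "hermitian_on ?S (\<lambda>\<mu> \<nu>. X (inv s \<mu>) (inv s \<nu>))"
      using X(2) S unfolding hermitian_on_def by blast
    show "X (inv s \<mu>) (inv s \<nu>) = X (inv s \<mu>') (inv s \<nu>')"
      if "\<mu> \<in> ?S" "\<nu> \<in> ?S" "\<mu>' \<in> ?S" "\<nu>' \<in> ?S" "\<mu> - \<nu> = \<mu>' - \<nu>'" for \<mu> \<nu> \<mu>' \<nu>'
      using X(3) S diff that by metis
  qed
qed

lemma matrix_act_comp:
  assumes "bij s" "bij t"
  shows "matrix_act t (matrix_act s X) = matrix_act (t \<circ> s) X"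
  using assms by (simp add: fun_eq_iff matrix_act_def o_inv_distrib)

text \<open>
  The matrix of an invariant \<open>f\<close> is fixed by the group. It is given explicitly by spreading each
  coefficient of \<open>f\<close> evenly over the corresponding diagonal; both it and its transforms are
  Toeplitz matrices representing \<open>f\<close>, so they agree by independence of the exponentials.
\<close>

lemma matrix_act_toep_mat:
  fixes \<Omega> :: "'v::real_inner set"
  assumes lat: "full_lattice \<Omega>"
    and W: "finite_linear_group W"
    and f: "trig_poly \<Omega> c f" "trig_invariant W c f"
    and supp: "\<And>\<mu>. c \<mu> \<noteq> 0 \<Longrightarrow>
           \<exists>\<alpha>\<in>truncated_lattice \<Omega> d. \<exists>\<beta>\<in>truncated_lattice \<Omega> d. \<mu> = \<alpha> + \<beta>"
    and stable: "\<And>s. s \<in> W \<Longrightarrow> s ` truncated_lattice \<Omega> d = truncated_lattice \<Omega> d"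
    and s: "s \<in> W"
  shows "matrix_act s (toep_mat \<Omega> d f) = toep_mat \<Omega> d f"
proof -
  define S where "S = truncated_lattice \<Omega> d"
  define n where "n = card S"
  have fin: "finite S" unfolding S_def by (rule finite_truncated_lattice[OF lat])
  have n: "n > 0"
    using fin zero_in_truncated_lattice[OF lat, of d] unfolding n_def S_def by (auto simp: card_gt_0_iff)
  have finc: "finite {\<mu>. c \<mu> \<noteq> 0}" and herm: "c \<mu> = cnj (c (- \<mu>))" for \<mu>
    using f(1) unfolding trig_poly_def by blast+
  \<comment> \<open>Since \<open>S = -S\<close>, sums of elements of \<open>S\<close> are the same as differences.\<close>
  have supp': "\<exists>\<mu>\<in>S. \<exists>\<nu>\<in>S. \<delta> = \<nu> - \<mu>" if c: "c \<delta> \<noteq> 0" for \<delta>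
  proof -
    obtain \<alpha> \<beta> where "\<alpha> \<in> S" "\<beta> \<in> S" "\<delta> = \<alpha> + \<beta>" using supp[OF c] unfolding S_def by blast
    moreover have "- \<beta> \<in> S"
      using uminus_in_truncated_lattice[OF lat] \<open>\<beta> \<in> S\<close> unfolding S_def by blast
    ultimately show ?thesis by (intro bexI[of _ "- \<beta>"] bexI[of _ \<alpha>]) auto
  qed
  define M where "M \<mu> \<nu> = (if \<mu> \<in> S \<and> \<nu> \<in> S
      then of_nat n * c (\<nu> - \<mu>) / of_nat (card (diagonal_on S (\<nu> - \<mu>))) else 0)" for \<mu> \<nu>
  have M_Toep: "M \<in> Toep \<Omega> d"
    unfolding Toep_def Let_def mem_Collect_eq S_def[symmetric]
  proof (intro conjI ballI allI impI)
    show "M \<mu> \<nu> = 0" if "\<not> (\<mu> \<in> S \<and> \<nu> \<in> S)" for \<mu> \<nu>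
      using that unfolding M_def by auto
    show "hermitian_on S M"
      unfolding hermitian_on_def
    proof (intro ballI)
      fix \<mu> \<nu> assume "\<mu> \<in> S" "\<nu> \<in> S"
      moreover have "c (\<nu> - \<mu>) = cnj (c (\<mu> - \<nu>))" using herm[of "\<nu> - \<mu>"] by simp
      moreover have "card (diagonal_on S (\<nu> - \<mu>)) = card (diagonal_on S (\<mu> - \<nu>))"
        using card_diagonal_on_uminus[of S "\<mu> - \<nu>"] by simp
      ultimately show "M \<mu> \<nu> = cnj (M \<nu> \<mu>)" by (simp add: M_def)
    qed
    show "M \<mu> \<nu> = M \<mu>' \<nu>'"
      if "\<mu> \<in> S" "\<nu> \<in> S" "\<mu>' \<in> S" "\<nu>' \<in> S" "\<mu> - \<nu> = \<mu>' - \<nu>'" for \<mu> \<nu> \<mu>' \<nu>'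
    proof -
      have "\<nu> - \<mu> = \<nu>' - \<mu>'" using that(5) by (metis minus_diff_eq)
      then show ?thesis using that(1-4) by (simp add: M_def)
    qed
  qed
  have M_form: "(\<Sum>\<mu>\<in>S. \<Sum>\<nu>\<in>S. M \<mu> \<nu> * lattice_exp (t (\<nu> - \<mu>)) u) = of_nat n * of_real (f u)"
    if t: "t \<in> W" for t u
  proof -
    have "(\<Sum>\<mu>\<in>S. \<Sum>\<nu>\<in>S. M \<mu> \<nu> * lattice_exp (t (\<nu> - \<mu>)) u)
       = of_nat n * (\<Sum>\<mu>\<in>S. \<Sum>\<nu>\<in>S. c (\<nu> - \<mu>) * lattice_exp (t (\<nu> - \<mu>)) u
            / of_nat (card (diagonal_on S (\<nu> - \<mu>))))"
      unfolding sum_distrib_left by (intro sum.cong refl) (simp add: M_def)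
    also have "\<dots> = of_nat n * trig_act t c u"
      unfolding trig_act_def
      by (subst sum_spread_diagonals[OF fin, of "\<lambda>\<delta>. c \<delta> * lattice_exp (t \<delta>) u" "{\<delta>. c \<delta> \<noteq> 0}"])
        (use finc supp' in auto)
    also have "trig_act t c u = of_real (f u)"
      using f(2) t by (auto simp: trig_invariant_def)
    finally show ?thesis .
  qed
  have rep: "toep_mat \<Omega> d f = M"
    unfolding toep_mat_def
  proof (rule the_equality)
    have id: "id \<in> W" using W by (simp add: finite_linear_group_def)
    show "M \<in> Toep \<Omega> d \<and> (\<forall>u. complex_of_real (f u) =
       (\<Sum>\<mu>\<in>truncated_lattice \<Omega> d. \<Sum>\<nu>\<in>truncated_lattice \<Omega> d.
          cnj (E_vec \<Omega> d u \<mu>) * M \<mu> \<nu> * E_vec \<Omega> d u \<nu>))"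
      unfolding E_vec_form[OF fin[unfolded S_def]] unfolding S_def[symmetric]
      using M_Toep M_form[OF id] n by (simp add: n_def)
    fix M' assume M': "M' \<in> Toep \<Omega> d \<and> (\<forall>u. complex_of_real (f u) =
       (\<Sum>\<mu>\<in>truncated_lattice \<Omega> d. \<Sum>\<nu>\<in>truncated_lattice \<Omega> d.
          cnj (E_vec \<Omega> d u \<mu>) * M' \<mu> \<nu> * E_vec \<Omega> d u \<nu>))"
    show "M' = M"
    proof (rule Toep_eqI[OF fin[unfolded S_def]])
      show "(\<Sum>\<mu>\<in>truncated_lattice \<Omega> d. \<Sum>\<nu>\<in>truncated_lattice \<Omega> d. M' \<mu> \<nu> * lattice_exp (\<nu> - \<mu>) u)
        = (\<Sum>\<mu>\<in>truncated_lattice \<Omega> d. \<Sum>\<nu>\<in>truncated_lattice \<Omega> d. M \<mu> \<nu> * lattice_exp (\<nu> - \<mu>) u)" for u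
        using M' M_form[OF id] n
        unfolding E_vec_form[OF fin[unfolded S_def]] unfolding S_def[symmetric]
        by (simp add: n_def[symmetric] field_simps)
    qed (use M' M_Toep in auto)
  qed
  have lin: "linear s" and bij: "bij s" using finite_linear_groupD[OF W s] by auto
  have sS: "s ` S = S" using stable[OF s] by (simp add: S_def)
  have "matrix_act s M = M"
  proof (rule Toep_eqI[OF fin[unfolded S_def]])
    show "matrix_act s M \<in> Toep \<Omega> d"
      by (rule Toep_matrix_act[OF lin bij stable[OF s] M_Toep])
    have id: "id \<in> W" using W by (simp add: finite_linear_group_def)
    have "(\<Sum>\<mu>\<in>S. \<Sum>\<nu>\<in>S. matrix_act s M \<mu> \<nu> * lattice_exp (\<nu> - \<mu>) u)
        = (\<Sum>\<mu>\<in>S. \<Sum>\<nu>\<in>S. M \<mu> \<nu> * lattice_exp (s (\<nu> - \<mu>)) u)" for u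
      using sum_matrix_act[OF bij sS, of "\<lambda>\<mu> \<nu> y. y * lattice_exp (\<nu> - \<mu>) u" M] lin
      by (simp add: linear_diff)
    then show "(\<Sum>\<mu>\<in>truncated_lattice \<Omega> d. \<Sum>\<nu>\<in>truncated_lattice \<Omega> d. matrix_act s M \<mu> \<nu> * lattice_exp (\<nu> - \<mu>) u)
        = (\<Sum>\<mu>\<in>truncated_lattice \<Omega> d. \<Sum>\<nu>\<in>truncated_lattice \<Omega> d. M \<mu> \<nu> * lattice_exp (\<nu> - \<mu>) u)" for u
      unfolding S_def[symmetric] using M_form[OF s] M_form[OF id] by simp
  qed (rule M_Toep)
  then show ?thesis by (simp add: rep)
qed


section \<open>Averaging over the group\<close>

text \<open>
  The Reynolds operator: the mean of all transforms of \<open>X\<close>. It keeps a matrix feasible and makes it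
  invariant.
\<close>

definition matrix_average :: "('v \<Rightarrow> 'v) set \<Rightarrow> ('v \<Rightarrow> 'v \<Rightarrow> complex) \<Rightarrow> 'v \<Rightarrow> 'v \<Rightarrow> complex" where
  "matrix_average W X \<mu> \<nu> = (\<Sum>s\<in>W. matrix_act s X \<mu> \<nu>) / of_nat (card W)"

lemma finite_linear_group_card_pos:
  assumes "finite_linear_group W"
  shows "card W > 0"
  using assms by (auto simp: finite_linear_group_def card_gt_0_iff)

lemma sum_div_nonneg_Reals:
  fixes g :: "'a \<Rightarrow> complex"
  assumes "\<And>x. x \<in> A \<Longrightarrow> g x \<in> \<real>\<^sub>\<ge>\<^sub>0"
  shows "(\<Sum>x\<in>A. g x) / of_nat k \<in> \<real>\<^sub>\<ge>\<^sub>0"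
proof -
  have "(\<Sum>x\<in>A. g x) \<in> \<real>\<^sub>\<ge>\<^sub>0"
    using assms by (induction A rule: infinite_finite_induct) auto
  then show ?thesis by (intro nonneg_Reals_divide_I) auto
qed

text \<open>Any functional \<open>\<Sum>\<^sub>\<mu>\<^sub>\<nu> g \<mu> \<nu> (X \<mu> \<nu>)\<close> with additive, homogeneous \<open>g \<mu> \<nu>\<close> commutes with averaging.\<close>

lemma sum_matrix_average:
  assumes "\<And>\<mu> \<nu> x y. g \<mu> \<nu> (x + y) = g \<mu> \<nu> x + g \<mu> \<nu> y" "\<And>\<mu> \<nu>. g \<mu> \<nu> 0 = (0::complex)"
    "\<And>\<mu> \<nu> x k. g \<mu> \<nu> (x / of_nat k) = g \<mu> \<nu> x / of_nat k"
  shows "(\<Sum>\<mu>\<in>S. \<Sum>\<nu>\<in>S. g \<mu> \<nu> (matrix_average W X \<mu> \<nu>))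
     = (\<Sum>s\<in>W. \<Sum>\<mu>\<in>S. \<Sum>\<nu>\<in>S. g \<mu> \<nu> (matrix_act s X \<mu> \<nu>)) / of_nat (card W)"
proof -
  have "g \<mu> \<nu> (\<Sum>s\<in>W. h s) = (\<Sum>s\<in>W. g \<mu> \<nu> (h s))" for \<mu> \<nu> h
    by (induction W rule: infinite_finite_induct) (simp_all add: assms)
  then have "(\<Sum>\<mu>\<in>S. \<Sum>\<nu>\<in>S. g \<mu> \<nu> (matrix_average W X \<mu> \<nu>))
      = (\<Sum>\<mu>\<in>S. \<Sum>\<nu>\<in>S. \<Sum>s\<in>W. g \<mu> \<nu> (matrix_act s X \<mu> \<nu>)) / of_nat (card W)"
    by (simp add: matrix_average_def assms sum_divide_distrib)
  also have "(\<Sum>\<mu>\<in>S. \<Sum>\<nu>\<in>S. \<Sum>s\<in>W. g \<mu> \<nu> (matrix_act s X \<mu> \<nu>))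
      = (\<Sum>s\<in>W. \<Sum>\<mu>\<in>S. \<Sum>\<nu>\<in>S. g \<mu> \<nu> (matrix_act s X \<mu> \<nu>))"
    by (simp only: sum.swap[of _ W])
  finally show ?thesis .
qed

lemma matrix_act_average:
  assumes W: "finite_linear_group W" and t: "t \<in> W"
  shows "matrix_act t (matrix_average W X) = matrix_average W X"
proof -
  have "(\<Sum>s\<in>W. matrix_act (t \<circ> s) X \<mu> \<nu>) = (\<Sum>s\<in>W. matrix_act s X \<mu> \<nu>)" for \<mu> \<nu>
  proof (rule sum.reindex_bij_witness[of _ "\<lambda>s. inv t \<circ> s" "\<lambda>s. t \<circ> s"])
    have "bij t" using finite_linear_groupD[OF W t] by auto
    then have t1: "inv t \<circ> t = id" "t \<circ> inv t = id"
      by (simp_all add: bij_is_inj bij_is_surj surj_iff[symmetric])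
    show "inv t \<circ> (t \<circ> s) = s" "t \<circ> (inv t \<circ> s) = s" for s
      by (simp_all only: o_assoc t1 id_o)
  qed (use W t in \<open>auto simp: finite_linear_group_def\<close>)
  moreover have "matrix_act t (matrix_act s X) = matrix_act (t \<circ> s) X" if "s \<in> W" for s
    using finite_linear_groupD[OF W] t that by (intro matrix_act_comp)
  then have "matrix_act t (matrix_average W X) \<mu> \<nu> = (\<Sum>s\<in>W. matrix_act (t \<circ> s) X \<mu> \<nu>) / of_nat (card W)"
    for \<mu> \<nu>
    by (simp add: matrix_average_def fun_eq_iff matrix_act_def)
  ultimately show ?thesis by (simp add: fun_eq_iff matrix_average_def)
qed

lemma matrix_average_Toep_inv:
  fixes \<Omega> :: "'v::real_inner set"
  assumes W: "finite_linear_group W"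
    and stable: "\<And>s. s \<in> W \<Longrightarrow> s ` truncated_lattice \<Omega> d = truncated_lattice \<Omega> d"
    and X: "X \<in> Toep \<Omega> d"
  shows "matrix_average W X \<in> Toep_inv W \<Omega> d"
proof -
  let ?S = "truncated_lattice \<Omega> d"
  have act: "matrix_act s X \<in> Toep \<Omega> d" if "s \<in> W" for s
    using Toep_matrix_act[OF _ _ stable X] finite_linear_groupD[OF W] that by blast
  have "matrix_average W X \<in> Toep \<Omega> d"
    unfolding Toep_def Let_def mem_Collect_eq
  proof (intro conjI ballI allI impI)
    show "matrix_average W X \<mu> \<nu> = 0" if "\<not> (\<mu> \<in> ?S \<and> \<nu> \<in> ?S)" for \<mu> \<nu>
      using act that by (simp add: matrix_average_def Toep_def Let_def)
    have "matrix_act s X \<mu> \<nu> = cnj (matrix_act s X \<nu> \<mu>)" if "s \<in> W" "\<mu> \<in> ?S" "\<nu> \<in> ?S" for s \<mu> \<nu>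
      using act[OF that(1)] that(2,3) unfolding Toep_def hermitian_on_def Let_def by blast
    then show "hermitian_on ?S (matrix_average W X)"
      unfolding hermitian_on_def matrix_average_def complex_cnj_divide cnj_sum complex_cnj_of_nat
      by (intro ballI arg_cong2[of _ _ _ _ divide] sum.cong refl)
    show "matrix_average W X \<mu> \<nu> = matrix_average W X \<mu>' \<nu>'"
      if "\<mu> \<in> ?S" "\<nu> \<in> ?S" "\<mu>' \<in> ?S" "\<nu>' \<in> ?S" "\<mu> - \<nu> = \<mu>' - \<nu>'" for \<mu> \<nu> \<mu>' \<nu>'
    proof -
      have "matrix_act s X \<mu> \<nu> = matrix_act s X \<mu>' \<nu>'" if "s \<in> W" for s
        using act[OF that] \<open>\<mu> \<in> ?S\<close> \<open>\<nu> \<in> ?S\<close> \<open>\<mu>' \<in> ?S\<close> \<open>\<nu>' \<in> ?S\<close> \<open>\<mu> - \<nu> = \<mu>' - \<nu>'\<close>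
        unfolding Toep_def Let_def by blast
      then show ?thesis by (simp add: matrix_average_def)
    qed
  qed
  then show ?thesis
    using matrix_act_average[OF W] by (simp add: Toep_inv_def)
qed

lemma psd_matrix_average:
  assumes W: "finite_linear_group W" and stable: "\<And>s. s \<in> W \<Longrightarrow> s ` S = S" and X: "psd_on S X"
  shows "psd_on S (matrix_average W X)"
proof -
  have act: "psd_on S (matrix_act s X)" if "s \<in> W" for s
    using psd_matrix_act[OF _ stable X] finite_linear_groupD[OF W] that by blast
  have "(\<Sum>\<mu>\<in>S. \<Sum>\<nu>\<in>S. cnj (z \<mu>) * matrix_average W X \<mu> \<nu> * z \<nu>) \<in> \<real>\<^sub>\<ge>\<^sub>0" for z
  proof -
    have "(\<Sum>\<mu>\<in>S. \<Sum>\<nu>\<in>S. cnj (z \<mu>) * matrix_average W X \<mu> \<nu> * z \<nu>)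
        = (\<Sum>s\<in>W. \<Sum>\<mu>\<in>S. \<Sum>\<nu>\<in>S. cnj (z \<mu>) * matrix_act s X \<mu> \<nu> * z \<nu>) / of_nat (card W)"
      by (rule sum_matrix_average[of "\<lambda>\<mu> \<nu> y. cnj (z \<mu>) * y * z \<nu>"]) (simp_all add: algebra_simps)
    also have "\<dots> \<in> \<real>\<^sub>\<ge>\<^sub>0"
      using act by (intro sum_div_nonneg_Reals psd_onD)
    finally show ?thesis .
  qed
  moreover have "matrix_act s X \<mu> \<nu> = cnj (matrix_act s X \<nu> \<mu>)" if "s \<in> W" "\<mu> \<in> S" "\<nu> \<in> S" for s \<mu> \<nu>
    using act[OF that(1)] that(2,3) unfolding psd_on_def hermitian_on_def by blast
  then have "hermitian_on S (matrix_average W X)"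
    unfolding hermitian_on_def matrix_average_def complex_cnj_divide cnj_sum complex_cnj_of_nat
    by (intro ballI arg_cong2[of _ _ _ _ divide] sum.cong refl)
  ultimately show ?thesis by (simp add: psd_on_def)
qed

lemma trace_matrix_average:
  assumes W: "finite_linear_group W" and stable: "\<And>s. s \<in> W \<Longrightarrow> s ` S = S"
  shows "trace_on S (matrix_average W X) = trace_on S X"
proof -
  have "trace_on S (matrix_average W X) = (\<Sum>s\<in>W. trace_on S (matrix_act s X)) / of_nat (card W)"
    unfolding trace_on_def matrix_average_def by (subst sum.swap) (simp add: sum_divide_distrib)
  also have "\<dots> = (\<Sum>s\<in>W. trace_on S X) / of_nat (card W)"
    using trace_matrix_act[OF _ stable] finite_linear_groupD(2)[OF W] by simp
  finally show ?thesis using finite_linear_group_card_pos[OF W] by simp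
qed

text \<open>The objective function does not see the averaging, because its matrix \<open>M\<close> is invariant.\<close>

lemma trace_matmul_matrix_average:
  assumes W: "finite_linear_group W" and stable: "\<And>s. s \<in> W \<Longrightarrow> s ` S = S"
    and M: "\<And>s. s \<in> W \<Longrightarrow> matrix_act s M = M"
  shows "trace_on S (matmul_on S M (matrix_average W X)) = trace_on S (matmul_on S M X)"
proof -
  have tr: "trace_on S (matmul_on S M Y) = (\<Sum>\<mu>\<in>S. \<Sum>\<nu>\<in>S. M \<nu> \<mu> * Y \<mu> \<nu>)" for Y
    unfolding trace_on_def matmul_on_def by (rule sum.swap)
  have act: "trace_on S (matmul_on S M (matrix_act s X)) = trace_on S (matmul_on S M X)" if "s \<in> W" for s
  proof -
    have bij: "bij s" using finite_linear_groupD[OF W that] by auto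
    have "M (s \<mu>) (s \<nu>) = M \<mu> \<nu>" for \<mu> \<nu>
      using fun_cong[OF fun_cong[OF M[OF that]], of "s \<mu>" "s \<nu>"] bij
      by (simp add: matrix_act_def bij_is_inj)
    then show ?thesis
      using sum_matrix_act[OF bij stable[OF that], of "\<lambda>\<mu> \<nu> y. M \<nu> \<mu> * y" X] by (simp add: tr)
  qed
  have "trace_on S (matmul_on S M (matrix_average W X))
      = (\<Sum>s\<in>W. trace_on S (matmul_on S M (matrix_act s X))) / of_nat (card W)"
    unfolding tr by (rule sum_matrix_average[of "\<lambda>\<mu> \<nu> y. M \<nu> \<mu> * y"]) (simp_all add: algebra_simps)
  then show ?thesis using act finite_linear_group_card_pos[OF W] by simp
qed

lemma sdp_values_Toep_inv:
  fixes \<Omega> :: "'v::real_inner set"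
  assumes W: "finite_linear_group W"
    and stable: "\<And>s. s \<in> W \<Longrightarrow> s ` truncated_lattice \<Omega> d = truncated_lattice \<Omega> d"
    and inv: "\<And>s. s \<in> W \<Longrightarrow> matrix_act s (toep_mat \<Omega> d f) = toep_mat \<Omega> d f"
  shows "sdp_values \<Omega> d f (Toep_inv W \<Omega> d) = sdp_values \<Omega> d f (Toep \<Omega> d)"
proof
  show "sdp_values \<Omega> d f (Toep_inv W \<Omega> d) \<subseteq> sdp_values \<Omega> d f (Toep \<Omega> d)"
    by (auto simp: sdp_values_def Toep_inv_def Let_def)
  show "sdp_values \<Omega> d f (Toep \<Omega> d) \<subseteq> sdp_values \<Omega> d f (Toep_inv W \<Omega> d)"
  proof
    fix v assume "v \<in> sdp_values \<Omega> d f (Toep \<Omega> d)"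
    then obtain X where X: "X \<in> Toep \<Omega> d" "psd_on (truncated_lattice \<Omega> d) X"
        "trace_on (truncated_lattice \<Omega> d) X = 1"
        "v = Re (trace_on (truncated_lattice \<Omega> d) (matmul_on (truncated_lattice \<Omega> d) (toep_mat \<Omega> d f) X))"
      by (auto simp: sdp_values_def Let_def)
    show "v \<in> sdp_values \<Omega> d f (Toep_inv W \<Omega> d)"
      unfolding sdp_values_def Let_def mem_Collect_eq
      using matrix_average_Toep_inv[OF W stable X(1)] psd_matrix_average[OF W stable X(2)]
        trace_matrix_average[OF W stable, of X] trace_matmul_matrix_average[OF W stable inv, of X] X(3,4)
      by (intro exI[of _ "matrix_average W X"]) simp
  qed
qed


section \<open>Existence of a minimizer\<close>

lemma compact_pointwise:
  fixes K :: "'a \<Rightarrow> 'b::topological_space set"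
  assumes "\<And>i. compact (K i)"
  shows "compact {x. \<forall>i. x i \<in> K i}"
proof -
  have "compactin (product_topology (\<lambda>i. euclidean) UNIV) (PiE UNIV K)"
    using assms by (simp add: compactin_PiE)
  moreover have "PiE UNIV K = {x. \<forall>i. x i \<in> K i}" by (auto simp: PiE_def Pi_def)
  ultimately show ?thesis by (simp add: euclidean_product_topology)
qed

lemma psd_on_subset:
  assumes "psd_on S X" "T \<subseteq> S" "finite S"
  shows "psd_on T X"
proof -
  have "finite T" using assms(2,3) by (rule finite_subset)
  have "(\<Sum>\<mu>\<in>T. \<Sum>\<nu>\<in>T. cnj (z \<mu>) * X \<mu> \<nu> * z \<nu>) \<in> \<real>\<^sub>\<ge>\<^sub>0" for z
  proof -
    define z' where "z' x = (if x \<in> T then z x else 0)" for x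
    have "(\<Sum>\<nu>\<in>S. cnj (z' \<mu>) * X \<mu> \<nu> * z' \<nu>) = (\<Sum>\<nu>\<in>T. cnj (z' \<mu>) * X \<mu> \<nu> * z \<nu>)" for \<mu>
      using assms \<open>finite T\<close> by (intro sum.mono_neutral_cong_right) (auto simp: z'_def)
    then have "(\<Sum>\<mu>\<in>S. \<Sum>\<nu>\<in>S. cnj (z' \<mu>) * X \<mu> \<nu> * z' \<nu>) = (\<Sum>\<mu>\<in>S. \<Sum>\<nu>\<in>T. cnj (z' \<mu>) * X \<mu> \<nu> * z \<nu>)"
      by simp
    also have "\<dots> = (\<Sum>\<mu>\<in>T. \<Sum>\<nu>\<in>T. cnj (z \<mu>) * X \<mu> \<nu> * z \<nu>)"
      using assms \<open>finite T\<close> by (intro sum.mono_neutral_cong_right) (auto simp: z'_def)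
    finally show ?thesis using psd_onD[OF assms(1), of z'] by (simp only:)
  qed
  moreover have "hermitian_on T X"
    using assms(1,2) unfolding psd_on_def hermitian_on_def by blast
  ultimately show ?thesis by (simp add: psd_on_def)
qed

text \<open>
  Off the diagonal, testing with the vector supported on \<open>\<mu>\<close> and \<open>\<nu>\<close> whose phase turns the cross terms
  into \<open>-\<bar>X\<^bsub>\<mu>\<nu>\<^esub>\<bar>\<close> bounds the entry by half the sum of two diagonal entries.
\<close>

lemma psd_entry_bound:
  assumes psd: "psd_on S X" and fin: "finite S" and tr: "trace_on S X = 1"
    and "\<mu> \<in> S" "\<nu> \<in> S"
  shows "norm (X \<mu> \<nu>) \<le> 1"
proof -
  have diag: "Re (X \<kappa> \<kappa>) \<ge> 0 \<and> Im (X \<kappa> \<kappa>) = 0" if "\<kappa> \<in> S" for \<kappa>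
  proof -
    have "psd_on {\<kappa>} X" using psd_on_subset[OF psd _ fin] that by simp
    from psd_onD[OF this, of "\<lambda>_. 1"] show ?thesis by (simp add: complex_nonneg_Reals_iff)
  qed
  have Re_tr: "(\<Sum>\<kappa>\<in>S. Re (X \<kappa> \<kappa>)) = 1"
    using arg_cong[OF tr, of Re] by (simp add: trace_on_def)
  show ?thesis
  proof (cases "\<mu> = \<nu>")
    case True
    have "Re (X \<mu> \<mu>) \<le> 1"
      using member_le_sum[of \<mu> S "\<lambda>\<kappa>. Re (X \<kappa> \<kappa>)"] diag fin assms(4) Re_tr by auto
    then show ?thesis
      using True diag[OF assms(4)] by (simp add: cmod_eq_Re)
  next
    case False
    have le1: "Re (X \<mu> \<mu>) + Re (X \<nu> \<nu>) \<le> 1"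
      using sum_mono2[of S "{\<mu>, \<nu>}" "\<lambda>\<kappa>. Re (X \<kappa> \<kappa>)"] diag fin assms(4,5) Re_tr False by auto
    \<comment> \<open>\<open>sgn z = z / \<bar>z\<bar>\<close>, with the value \<open>0\<close> at \<open>z = 0\<close>, so \<open>\<bar>b\<bar>\<close> is \<open>1\<close> or \<open>0\<close>.\<close>
    define b where "b = - cnj (sgn (X \<mu> \<nu>))"
    define z where "z x = (if x = \<mu> then 1 else b)" for x
    have psd2: "psd_on {\<mu>, \<nu>} X" using psd_on_subset[OF psd _ fin] assms(4,5) by simp
    have herm: "X \<nu> \<mu> = cnj (X \<mu> \<nu>)"
      using psd assms(4,5) unfolding psd_on_def hermitian_on_def by blast
    have b1: "X \<mu> \<nu> * b = - of_real (norm (X \<mu> \<nu>))"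
    proof (cases "X \<mu> \<nu> = 0")
      case False
      have "X \<mu> \<nu> * b = - (X \<mu> \<nu> * cnj (X \<mu> \<nu>)) / of_real (norm (X \<mu> \<nu>))"
        by (simp add: b_def sgn_div_norm scaleR_conv_of_real field_simps)
      also have "\<dots> = - of_real (norm (X \<mu> \<nu>))"
        using False by (simp add: complex_norm_square[symmetric] power2_eq_square)
      finally show ?thesis .
    qed simp
    have b2: "cnj b * X \<nu> \<mu> = - of_real (norm (X \<mu> \<nu>))"
      using arg_cong[OF b1, of cnj] by (simp add: herm mult.commute)
    have b3: "norm b \<le> 1" by (simp add: b_def norm_sgn)
    have "(\<Sum>x\<in>{\<mu>, \<nu>}. \<Sum>y\<in>{\<mu>, \<nu>}. cnj (z x) * X x y * z y) \<in> \<real>\<^sub>\<ge>\<^sub>0"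
      by (rule psd_onD[OF psd2])
    moreover have "(\<Sum>x\<in>{\<mu>, \<nu>}. \<Sum>y\<in>{\<mu>, \<nu>}. cnj (z x) * X x y * z y)
        = X \<mu> \<mu> + X \<mu> \<nu> * b + (cnj b * X \<nu> \<mu> + (b * cnj b) * X \<nu> \<nu>)"
      using False by (simp add: z_def mult_ac)
    also have "\<dots> = X \<mu> \<mu> - 2 * of_real (norm (X \<mu> \<nu>)) + of_real ((norm b)\<^sup>2) * X \<nu> \<nu>"
      unfolding b1 b2 complex_norm_square[symmetric] by (simp add: of_real_def)
    ultimately have "0 \<le> Re (X \<mu> \<mu>) - 2 * norm (X \<mu> \<nu>) + (norm b)\<^sup>2 * Re (X \<nu> \<nu>)"
      by (simp add: complex_nonneg_Reals_iff)
    moreover have "(norm b)\<^sup>2 * Re (X \<nu> \<nu>) \<le> 1 * Re (X \<nu> \<nu>)"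
      using b3 diag[OF assms(5)] by (intro mult_right_mono) (auto simp: power_le_one)
    ultimately show ?thesis using le1 by linarith
  qed
qed

lemma continuous_on_entry [continuous_intros]:
  "continuous_on A (\<lambda>X :: 'a \<Rightarrow> 'b \<Rightarrow> complex. X \<mu> \<nu>)"
proof -
  have "continuous_on A (\<lambda>X :: 'a \<Rightarrow> 'b \<Rightarrow> complex. X \<mu>)"
    using continuous_on_product_then_coordinatewise[of A "\<lambda>X. X" \<mu>] continuous_on_id by blast
  then show ?thesis
    by (rule continuous_on_product_then_coordinatewise[of A "\<lambda>X. X \<mu>" \<nu>])
qed

text \<open>
  The feasible set is closed, and its entries are bounded by \<open>1\<close>, so it is compact for the product
  topology on matrices.
\<close>

lemma compact_feasible:
  assumes fin: "finite (truncated_lattice \<Omega> d)"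
  shows "compact {X \<in> Toep \<Omega> d. psd_on (truncated_lattice \<Omega> d) X \<and> trace_on (truncated_lattice \<Omega> d) X = 1}"
    (is "compact ?F")
proof -
  let ?S = "truncated_lattice \<Omega> d"
  define K where "K \<mu> \<nu> = (if \<mu> \<in> ?S \<and> \<nu> \<in> ?S then cball (0::complex) 1 else {0})" for \<mu> \<nu>
  have "compact {x. \<forall>\<nu>. x \<nu> \<in> K \<mu> \<nu>}" for \<mu>
    by (rule compact_pointwise) (simp add: K_def)
  then have "compact {X. \<forall>\<mu>. X \<mu> \<in> {x. \<forall>\<nu>. x \<nu> \<in> K \<mu> \<nu>}}"
    by (rule compact_pointwise)
  moreover have "closed ?F"
    unfolding Toep_def hermitian_on_def psd_on_def trace_on_def Let_def mem_Collect_eq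
      Ball_def complex_nonneg_Reals_iff
    by (intro closed_Collect_conj closed_Collect_all closed_Collect_imp closed_Collect_eq
        closed_Collect_le continuous_intros open_Collect_const)
  ultimately have "compact ({X. \<forall>\<mu>. X \<mu> \<in> {x. \<forall>\<nu>. x \<nu> \<in> K \<mu> \<nu>}} \<inter> ?F)"
    by (rule compact_Int_closed)
  moreover have "?F \<subseteq> {X. \<forall>\<mu>. X \<mu> \<in> {x. \<forall>\<nu>. x \<nu> \<in> K \<mu> \<nu>}}"
    using psd_entry_bound[OF _ fin] by (auto simp: K_def Toep_def Let_def)
  ultimately show ?thesis by (simp add: Int_absorb1)
qed

lemma feasible_nonempty:
  assumes fin: "finite (truncated_lattice \<Omega> d)" and ne: "truncated_lattice \<Omega> d \<noteq> {}"
  shows "\<exists>X\<in>Toep \<Omega> d. psd_on (truncated_lattice \<Omega> d) X \<and> trace_on (truncated_lattice \<Omega> d) X = 1"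
proof
  let ?S = "truncated_lattice \<Omega> d"
  define n where "n = card ?S"
  have n: "n > 0" using assms by (simp add: n_def card_gt_0_iff)
  define X :: "'a \<Rightarrow> 'a \<Rightarrow> complex"
    where "X \<mu> \<nu> = (if \<mu> \<in> ?S \<and> \<mu> = \<nu> then 1 / of_nat n else 0)" for \<mu> \<nu>
  show "X \<in> Toep \<Omega> d"
    by (auto simp: Toep_def Let_def X_def hermitian_on_def)
  have "(\<Sum>\<mu>\<in>?S. \<Sum>\<nu>\<in>?S. cnj (z \<mu>) * X \<mu> \<nu> * z \<nu>) = (\<Sum>\<mu>\<in>?S. z \<mu> * cnj (z \<mu>)) / of_nat n" for z
  proof -
    have "(\<Sum>\<nu>\<in>?S. cnj (z \<mu>) * X \<mu> \<nu> * z \<nu>) = z \<mu> * cnj (z \<mu>) / of_nat n" if "\<mu> \<in> ?S" for \<mu>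
    proof -
      have "(\<Sum>\<nu>\<in>?S. cnj (z \<mu>) * X \<mu> \<nu> * z \<nu>)
          = (\<Sum>\<nu>\<in>?S. if \<nu> = \<mu> then z \<mu> * cnj (z \<mu>) / of_nat n else 0)"
        using that by (intro sum.cong) (auto simp: X_def)
      then show ?thesis using fin that by simp
    qed
    then show ?thesis by (simp add: sum_divide_distrib)
  qed
  moreover have "z * cnj z \<in> \<real>\<^sub>\<ge>\<^sub>0" for z
    by (simp add: complex_nonneg_Reals_iff)
  ultimately have "(\<Sum>\<mu>\<in>?S. \<Sum>\<nu>\<in>?S. cnj (z \<mu>) * X \<mu> \<nu> * z \<nu>) \<in> \<real>\<^sub>\<ge>\<^sub>0" for z
    by (simp only: sum_div_nonneg_Reals)
  moreover have "hermitian_on ?S X" by (auto simp: X_def hermitian_on_def)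
  moreover have "trace_on ?S X = 1"
    using n by (simp add: trace_on_def X_def n_def)
  ultimately show "psd_on ?S X \<and> trace_on ?S X = 1" by (simp add: psd_on_def)
qed

lemma is_minimum_The:
  assumes "is_minimum A m"
  shows "is_minimum A (THE m. is_minimum A m)"
  using assms by (rule theI) (use assms in \<open>auto simp: is_minimum_def intro: antisym\<close>)

lemma sdp_minimum_exists:
  fixes \<Omega> :: "'v::real_inner set"
  assumes "full_lattice \<Omega>"
  shows "\<exists>m. is_minimum (sdp_values \<Omega> d f (Toep \<Omega> d)) m"
proof -
  let ?S = "truncated_lattice \<Omega> d"
  let ?F = "{X \<in> Toep \<Omega> d. psd_on ?S X \<and> trace_on ?S X = 1}"
  define g where "g X = Re (trace_on ?S (matmul_on ?S (toep_mat \<Omega> d f) X))" for X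
  have fin: "finite ?S" and ne: "?S \<noteq> {}"
    using finite_truncated_lattice[OF assms] zero_in_truncated_lattice[OF assms] by auto
  have "?F \<noteq> {}" using feasible_nonempty[OF fin ne] by blast
  moreover have "continuous_on ?F g"
    unfolding g_def trace_on_def matmul_on_def
    by (intro continuous_intros)
  ultimately obtain X where X: "X \<in> ?F" "\<forall>Y\<in>?F. g X \<le> g Y"
    using continuous_attains_inf[OF compact_feasible[OF fin]] by blast
  have "sdp_values \<Omega> d f (Toep \<Omega> d) = g ` ?F"
    by (auto simp: sdp_values_def Let_def g_def)
  then have "is_minimum (sdp_values \<Omega> d f (Toep \<Omega> d)) (g X)"
    unfolding is_minimum_def using X by (simp only: ball_simps imageI)
  then show ?thesis ..
qed

section \<open>Equality of the two minima\<close>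

theorem proposition3p2:
  fixes \<Omega> :: "'v::real_inner set" and W :: "('v \<Rightarrow> 'v) set"
    and c :: "'v \<Rightarrow> complex" and f :: "'v \<Rightarrow> real" and d :: nat
  assumes "full_lattice \<Omega>"
    and "finite_linear_group W"
    and "\<And>s. s \<in> W \<Longrightarrow> s ` \<Omega> = \<Omega>"
    and "trig_poly \<Omega> c f"
    and "trig_invariant W c f"
    and "\<And>\<mu>. c \<mu> \<noteq> 0 \<Longrightarrow>
           \<exists>\<alpha>\<in>truncated_lattice \<Omega> d. \<exists>\<beta>\<in>truncated_lattice \<Omega> d. \<mu> = \<alpha> + \<beta>"
    and "\<And>s. s \<in> W \<Longrightarrow> s ` truncated_lattice \<Omega> d = truncated_lattice \<Omega> d"
  shows "is_minimum (sdp_values \<Omega> d f (Toep \<Omega> d)) (sdp_bound \<Omega> d f) \<and>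
    is_minimum (sdp_values \<Omega> d f (Toep_inv W \<Omega> d)) (sdp_bound_inv W \<Omega> d f) \<and>
    sdp_bound \<Omega> d f = sdp_bound_inv W \<Omega> d f"
proof -
  have inv: "matrix_act s (toep_mat \<Omega> d f) = toep_mat \<Omega> d f" if "s \<in> W" for s
    by (rule matrix_act_toep_mat[OF assms(1,2,4,5,6,7) that])
  have eq: "sdp_values \<Omega> d f (Toep_inv W \<Omega> d) = sdp_values \<Omega> d f (Toep \<Omega> d)"
    by (rule sdp_values_Toep_inv[OF assms(2,7) inv])
  have "is_minimum (sdp_values \<Omega> d f (Toep \<Omega> d)) (sdp_bound \<Omega> d f)"
    unfolding sdp_bound_def using sdp_minimum_exists[OF assms(1)] is_minimum_The by blast
  then show ?thesis by (simp add: sdp_bound_def sdp_bound_inv_def eq)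
qed

end
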